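(* Let $d,M\in\mathbb N_+$, let $(X,\rho)=([0,1]^d,\|\cdot\|_1)$, let $G\in\mathbb R^{M\times M}$ be fixed, and let $\theta=((a_m,b_m,c_m))_{m=1}^M\in(\mathbb R\times X\times[0,\infty))^M$. Then the algorithm described in the context constructs a ReLU-MLP $\Phi_{\theta,G}:\mathbb R^d\to\mathbb R$ of depth $\mathcal O(\log M)$, width $\mathcal O(M)$, and with $\mathcal O(M)$ nonzero parameters, where the hidden constants depend only on $d$, satisfying $$\Phi_{\theta,G}(x)=\hat f_\theta(x\mid G)\qquad\text{for every }x\in X,$$ where, with $a=(a_1,\dots,a_M)$ viewed as a row vector, $$\hat f_\theta(x\mid G):=\tfrac12\Big(\min_{1\le m\le M}\big((aG)_m+c_m\|x-b_m\|_1\big)+\max_{1\le m\le M}\big((aG)_m-c_m\|x-b_m\|_1\big)\Big).$$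
   Context: ReLU-MLP: a map $f:\mathbb R^{d_0}\to\mathbb R^{d_L}$ of the form $X^{(0)}=x$, $X^{(j+1)}=\operatorname{ReLU}(A^{(j)}X^{(j)}+b^{(j)})$ componentwise for $j=0,\dots,L-2$, and $f(x)=A^{(L-1)}X^{(L-1)}+b^{(L-1)}$, with matrices $A^{(j)}\in\mathbb R^{d_{j+1}\times d_j}$ and vectors $b^{(j)}\in\mathbb R^{d_{j+1}}$; $L$ is its depth, the maximum of the layer dimensions $d_j$ is its width, and the number of nonzero parameters is the total number of nonzero entries of all $A^{(j)},b^{(j)}$. Convention: "$\mathcal O(g(M))$" means at most $K_d\max\{1,g(M)\}$ for a constant $K_d$ depending only on $d$. Algorithm (input $\theta$, $G$). Put $K=\lceil\log_2M\rceil$, $V=aG$, $\operatorname{Min}_2(s,t)=\operatorname{ReLU}(t)-\operatorname{ReLU}(-t)-\operatorname{ReLU}(t-s)$ and $\operatorname{Max}_2(s,t)=-\operatorname{Min}_2(-s,-t)$. For $m=1,\dots,M$ set $D_m(x)=\mathbf 1_d^\top(\operatorname{ReLU}(x-b_m)+\operatorname{ReLU}(b_m-x))$, $U^{(0)}_m=V_m+c_mD_m(x)$, $L^{(0)}_m=V_m-c_mD_m(x)$. If $M<2^K$, pad by $U^{(0)}_r=U^{(0)}_M$, $L^{(0)}_r=L^{(0)}_M$ for $r=M+1,\dots,2^K$. For $\ell=1,\dots,K$ and $j=1,\dots,2^{K-\ell}$ set $U^{(\ell)}_j=\operatorname{Min}_2(U^{(\ell-1)}_{2j-1},U^{(\ell-1)}_{2j})$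 and $L^{(\ell)}_j=\operatorname{Max}_2(L^{(\ell-1)}_{2j-1},L^{(\ell-1)}_{2j})$. Output $\Phi_{\theta,G}(x)=\frac12(U^{(K)}_1+L^{(K)}_1)$. *)

theory Defs
  imports Complex_Main "Jordan_Normal_Form.Matrix"
begin

text \<open>
  Vectors and matrices carry their dimensions, so that \<open>carrier_vec n\<close> is \<open>\<real>\<^sup>n\<close> and
  \<open>carrier_mat m n\<close> is \<open>\<real>\<^sup>m\<^sup>\<times>\<^sup>n\<close>. All indices are 0-based: an index \<open>m\<close> here is the index
  \<open>m + 1\<close> of the mathematical text.
\<close>

definition relu :: "real \<Rightarrow> real" where
  "relu t = max 0 t"

abbreviation relu_vec :: "real vec \<Rightarrow> real vec" where
  "relu_vec \<equiv> map_vec relu"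

subsection \<open>ReLU-MLPs\<close>

type_synonym mlp = "(real mat \<times> real vec) list"

abbreviation weight :: "mlp \<Rightarrow> nat \<Rightarrow> real mat" where
  "weight N j \<equiv> fst (N ! j)"

abbreviation bias :: "mlp \<Rightarrow> nat \<Rightarrow> real vec" where
  "bias N j \<equiv> snd (N ! j)"

text \<open>The list \<open>[d\<^sub>0, \<dots>, d\<^sub>L]\<close>, input and output dimensions included.\<close>

definition layer_dims :: "mlp \<Rightarrow> nat list" where
  "layer_dims N = dim_col (weight N 0) # map (\<lambda>(A, b). dim_row A) N"

definition relu_mlp :: "nat \<Rightarrow> nat \<Rightarrow> mlp \<Rightarrow> bool" where
  "relu_mlp d_in d_out N \<longleftrightarrow>
     N \<noteq> [] \<and> hd (layer_dims N) = d_in \<and> last (layer_dims N) = d_out \<and>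
     (\<forall>k\<in>set (layer_dims N). 1 \<le> k) \<and>
     (\<forall>j<length N.
        weight N j \<in> carrier_mat (layer_dims N ! Suc j) (layer_dims N ! j) \<and>
        bias N j \<in> carrier_vec (layer_dims N ! Suc j))"

primrec mlp_state :: "mlp \<Rightarrow> real vec \<Rightarrow> nat \<Rightarrow> real vec" where
  "mlp_state N x 0 = x"
| "mlp_state N x (Suc j) = relu_vec (weight N j *\<^sub>v mlp_state N x j + bias N j)"

definition mlp_map :: "mlp \<Rightarrow> real vec \<Rightarrow> real vec" where
  "mlp_map N x =
     (let L = length N in weight N (L - 1) *\<^sub>v mlp_state N x (L - 1) + bias N (L - 1))"

definition mlp_depth :: "mlp \<Rightarrow> nat" where
  "mlp_depth N = length N"

definition mlp_width :: "mlp \<Rightarrow> nat" where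
  "mlp_width N = Max (set (layer_dims N))"

definition mlp_nonzero :: "mlp \<Rightarrow> nat" where
  "mlp_nonzero N =
     (\<Sum>j<length N.
        card {(r, s). r < dim_row (weight N j) \<and> s < dim_col (weight N j) \<and>
                      weight N j $$ (r, s) \<noteq> 0} +
        card {r. r < dim_vec (bias N j) \<and> bias N j $ r \<noteq> 0})"

subsection \<open>Parameters\<close>

definition unit_cube :: "nat \<Rightarrow> real vec set" where
  "unit_cube d = {x \<in> carrier_vec d. \<forall>i<d. 0 \<le> x $ i \<and> x $ i \<le> 1}"

definition l1_norm :: "real vec \<Rightarrow> real" where
  "l1_norm v = (\<Sum>i<dim_vec v. \<bar>v $ i\<bar>)"

type_synonym params = "(real \<times> real vec \<times> real) list"

definition param_space :: "nat \<Rightarrow> nat \<Rightarrow> params set" where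
  "param_space d M = {\<theta>. length \<theta> = M \<and> set \<theta> \<subseteq> UNIV \<times> unit_cube d \<times> {0..}}"

definition coef_a :: "params \<Rightarrow> real vec" where
  "coef_a \<theta> = vec (length \<theta>) (\<lambda>m. fst (\<theta> ! m))"

definition node_b :: "params \<Rightarrow> nat \<Rightarrow> real vec" where
  "node_b \<theta> m = fst (snd (\<theta> ! m))"

definition slope_c :: "params \<Rightarrow> nat \<Rightarrow> real" where
  "slope_c \<theta> m = snd (snd (\<theta> ! m))"

text \<open>The row vector \<open>aG\<close>.\<close>

definition values_V :: "params \<Rightarrow> real mat \<Rightarrow> real vec" where
  "values_V \<theta> G = row (mat_of_row (coef_a \<theta>) * G) 0"

definition f_hat :: "params \<Rightarrow> real mat \<Rightarrow> real vec \<Rightarrow> real" where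
  "f_hat \<theta> G x =
     1 / 2 * ((MIN m\<in>{..<length \<theta>}. values_V \<theta> G $ m + slope_c \<theta> m * l1_norm (x - node_b \<theta> m)) +
              (MAX m\<in>{..<length \<theta>}. values_V \<theta> G $ m - slope_c \<theta> m * l1_norm (x - node_b \<theta> m)))"

subsection \<open>The algorithm\<close>

definition Min2 :: "real \<Rightarrow> real \<Rightarrow> real" where
  "Min2 s t = relu t - relu (- t) - relu (t - s)"

definition Max2 :: "real \<Rightarrow> real \<Rightarrow> real" where
  "Max2 s t = - Min2 (- s) (- t)"

definition tree_height :: "nat \<Rightarrow> nat" where
  "tree_height M = nat \<lceil>log 2 (real M)\<rceil>"

definition dist_D :: "params \<Rightarrow> real vec \<Rightarrow> nat \<Rightarrow> real" where
  "dist_D \<theta> x m =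
     vec (dim_vec x) (\<lambda>_. 1) \<bullet> (relu_vec (x - node_b \<theta> m) + relu_vec (node_b \<theta> m - x))"

text \<open>
  Leaves with index at least \<open>M\<close> are the padding. At level \<open>l\<close> only the indices below
  \<open>2 ^ (tree_height M - l)\<close> belong to the algorithm; the other values are never used.
\<close>

definition pad_index :: "params \<Rightarrow> nat \<Rightarrow> nat" where
  "pad_index \<theta> r = (if r < length \<theta> then r else length \<theta> - 1)"

primrec upper_U :: "params \<Rightarrow> real mat \<Rightarrow> real vec \<Rightarrow> nat \<Rightarrow> nat \<Rightarrow> real" where
  "upper_U \<theta> G x 0 r =
     (let m = pad_index \<theta> r in values_V \<theta> G $ m + slope_c \<theta> m * dist_D \<theta> x m)"
| "upper_U \<theta> G x (Suc l) j = Min2 (upper_U \<theta> G x l (2 * j)) (upper_U \<theta> G x l (2 * j + 1))"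

primrec lower_L :: "params \<Rightarrow> real mat \<Rightarrow> real vec \<Rightarrow> nat \<Rightarrow> nat \<Rightarrow> real" where
  "lower_L \<theta> G x 0 r =
     (let m = pad_index \<theta> r in values_V \<theta> G $ m - slope_c \<theta> m * dist_D \<theta> x m)"
| "lower_L \<theta> G x (Suc l) j = Max2 (lower_L \<theta> G x l (2 * j)) (lower_L \<theta> G x l (2 * j + 1))"

definition Phi :: "params \<Rightarrow> real mat \<Rightarrow> real vec \<Rightarrow> real" where
  "Phi \<theta> G x =
     (let K = tree_height (length \<theta>) in 1 / 2 * (upper_U \<theta> G x K 0 + lower_L \<theta> G x K 0))"

end

theory Submission imports Defs begin

text \<open>
  Every hidden layer is built from a list of sparse affine readouts of the previous hidden state.
  The first layer computes the \<open>2dM\<close> ReLU terms of the distances. Level \<open>l\<close> of the two trees is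
  one further layer, with three neurons for each of the \<open>2 \<cdot> 2\<^sup>K\<^sup>-\<^sup>l\<close> nodes and a number of weights
  per neuron bounded in terms of \<open>d\<close>. The parameter count is therefore dominated by a geometric
  sum of order \<open>2\<^sup>K \<le> 2M\<close>.
\<close>

subsection \<open>Sparse vectors\<close>

definition nnz :: "real vec \<Rightarrow> nat" where
  "nnz v = card {i. i < dim_vec v \<and> v $ i \<noteq> 0}"

lemma nnz_add:
  assumes "u \<in> carrier_vec n" "v \<in> carrier_vec n"
  shows "nnz (u + v) \<le> nnz u + nnz v"
proof -
  have "nnz (u + v) \<le> card ({i. i < dim_vec u \<and> u $ i \<noteq> 0} \<union> {i. i < dim_vec v \<and> v $ i \<noteq> 0})"
    unfolding nnz_def by (rule card_mono) (use assms in auto)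
  also have "\<dots> \<le> nnz u + nnz v"
    unfolding nnz_def by (rule card_Un_le)
  finally show ?thesis .
qed

lemma nnz_smult: "nnz (c \<cdot>\<^sub>v v) \<le> nnz v"
  unfolding nnz_def by (rule card_mono) auto

lemma nnz_zero [simp]: "nnz (0\<^sub>v n) = 0"
  by (auto simp: nnz_def)

lemma nnz_unit: "nnz (unit_vec n i) \<le> 1"
proof -
  have "nnz (unit_vec n i) \<le> card {i}"
    unfolding nnz_def by (rule card_mono) (auto simp: unit_vec_def split: if_splits)
  then show ?thesis by simp
qed

text \<open>The summand of \<open>mlp_nonzero\<close> for one layer, so that an appended layer adds
  exactly this amount.\<close>

definition layer_nonzero :: "real mat \<times> real vec \<Rightarrow> nat" where
  "layer_nonzero l =
     card {(r, s). r < dim_row (fst l) \<and> s < dim_col (fst l) \<and> fst l $$ (r, s) \<noteq> 0} +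
     nnz (snd l)"

text \<open>Counting row by row: each of the \<open>m\<close> rows contributes at most
  \<open>s\<close> nonzero weights and its bias entry at most one more.\<close>

lemma layer_nonzero_le:
  assumes "A \<in> carrier_mat m n" "b \<in> carrier_vec m" "\<And>r. r < m \<Longrightarrow> nnz (row A r) \<le> s"
  shows "layer_nonzero (A, b) \<le> m * (s + 1)"
proof -
  have eq: "{(r, s). r < dim_row A \<and> s < dim_col A \<and> A $$ (r, s) \<noteq> 0} =
      (SIGMA r:{..<m}. {i. i < dim_vec (row A r) \<and> row A r $ i \<noteq> 0})"
    using assms(1) by auto
  have "card {(r, s). r < dim_row A \<and> s < dim_col A \<and> A $$ (r, s) \<noteq> 0} = (\<Sum>r<m. nnz (row A r))"
    unfolding eq nnz_def by (subst card_SigmaI) auto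
  also have "\<dots> \<le> (\<Sum>r<m. s)"
    by (rule sum_mono) (use assms(3) in auto)
  finally have "card {(r, s). r < dim_row A \<and> s < dim_col A \<and> A $$ (r, s) \<noteq> 0} \<le> m * s"
    by simp
  moreover have "nnz b \<le> card {..<m}"
    unfolding nnz_def by (rule card_mono) (use assms(2) in auto)
  ultimately show ?thesis
    by (simp add: layer_nonzero_def)
qed

subsection \<open>Appending layers\<close>

text \<open>
  The empty list is allowed here, with the input itself as hidden state, although it is not
  a \<open>relu_mlp\<close>.
\<close>

definition hidden :: "nat \<Rightarrow> nat \<Rightarrow> mlp \<Rightarrow> bool" where
  "hidden d n N \<longleftrightarrow> (if N = [] then n = d else relu_mlp d n N)"

lemma layer_dims_append:
  "N \<noteq> [] \<Longrightarrow> layer_dims (N @ [l]) = layer_dims N @ [dim_row (fst l)]"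
  by (auto simp: layer_dims_def nth_append split: prod.splits)

lemma length_layer_dims [simp]: "length (layer_dims N) = Suc (length N)"
  by (simp add: layer_dims_def)

lemma relu_mlp_append:
  assumes "hidden d n N" "A \<in> carrier_mat m n" "b \<in> carrier_vec m" "1 \<le> d" "1 \<le> m"
  shows "relu_mlp d m (N @ [(A, b)])"
proof (cases "N = []")
  case True
  then show ?thesis using assms
    by (auto simp: relu_mlp_def hidden_def layer_dims_def)
next
  case False
  then have N: "relu_mlp d n N" using assms by (simp add: hidden_def)
  have ne: "layer_dims N \<noteq> []" by (simp add: layer_dims_def)
  \<comment> \<open>At the junction, the column count of the new matrix has to match the output
    dimension of \<open>N\<close>.\<close>
  have last: "layer_dims N ! length N = n"
    using N ne by (simp add: relu_mlp_def last_conv_nth)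
  show ?thesis
    unfolding relu_mlp_def layer_dims_append[OF False]
    using N ne assms last
    by (auto simp: relu_mlp_def nth_append less_Suc_eq)
qed

lemma mlp_state_append:
  "j \<le> length N \<Longrightarrow> mlp_state (N @ N') x j = mlp_state N x j"
  by (induction j) (auto simp: nth_append)

lemma mlp_nonzero_append: "mlp_nonzero (N @ [l]) = mlp_nonzero N + layer_nonzero l"
  by (simp add: mlp_nonzero_def nth_append layer_nonzero_def nnz_def)

text \<open>The input dimension is also a layer dimension and is the row count of no matrix in the
  list, hence the separate bound on \<open>d\<close>.\<close>

lemma mlp_width_le:
  assumes "relu_mlp d n N" "d \<le> W" "\<And>l. l \<in> set N \<Longrightarrow> dim_row (fst l) \<le> W"
  shows "mlp_width N \<le> W"
proof -
  have "dim_col (weight N 0) = d"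
    using assms(1) by (simp add: relu_mlp_def layer_dims_def)
  then show ?thesis
    unfolding mlp_width_def layer_dims_def using assms by (auto split: prod.splits)
qed

text \<open>ReLU is applied after every layer, the last one included, so \<open>N\<close> is treated
  as a stack of hidden layers; \<open>mlp_map\<close> instead leaves the last layer affine. For the
  empty list this is the input.\<close>

abbreviation final_state :: "mlp \<Rightarrow> real vec \<Rightarrow> real vec" where
  "final_state N x \<equiv> mlp_state N x (length N)"

lemma final_state_append:
  "final_state (N @ [(A, b)]) x = relu_vec (A *\<^sub>v final_state N x + b)"
  by (simp add: mlp_state_append nth_append)

lemma mlp_map_append:
  "mlp_map (N @ [(A, b)]) x = A *\<^sub>v final_state N x + b"
  by (simp add: mlp_map_def mlp_state_append nth_append Let_def)

lemma final_state_carrier: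
  assumes "hidden d n N" "x \<in> carrier_vec d"
  shows "final_state N x \<in> carrier_vec n"
proof (cases "N = []")
  case True
  then show ?thesis using assms by (simp add: hidden_def)
next
  case False
  then obtain N' A b where N': "N = N' @ [(A, b)]" by (metis rev_exhaust surj_pair)
  have mlp: "relu_mlp d n N" using False assms(1) by (simp add: hidden_def)
  have "layer_dims N ! Suc (length N') = last (layer_dims N)"
    by (subst last_conv_nth) (auto simp: N' layer_dims_def)
  moreover have "bias N j \<in> carrier_vec (layer_dims N ! Suc j)" if "j < length N" for j
    using mlp that by (simp add: relu_mlp_def)
  from this[of "length N'"] have "b \<in> carrier_vec (layer_dims N ! Suc (length N'))"
    by (simp add: N')
  ultimately have "dim_vec b = n"
    using mlp by (simp add: relu_mlp_def)
  \<comment> \<open>The dimension of a vector sum is that of its second summand, so the bias alone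
    fixes the dimension of the state.\<close>
  then show ?thesis
    unfolding N' final_state_append by (intro carrier_vecI) simp
qed

subsection \<open>Sparse affine readouts of the hidden state\<close>

text \<open>The cost \<open>s\<close> counts weights only; the constant \<open>\<beta>\<close>
  becomes a bias entry and is charged once per neuron.\<close>

definition readout :: "nat \<Rightarrow> nat \<Rightarrow> mlp \<Rightarrow> nat \<Rightarrow> (real vec \<Rightarrow> real) \<Rightarrow> bool" where
  "readout d n N s f \<longleftrightarrow>
     (\<exists>w \<beta>. w \<in> carrier_vec n \<and> nnz w \<le> s \<and> (\<forall>x\<in>carrier_vec d. f x = w \<bullet> final_state N x + \<beta>))"

lemma readout_cong:
  "readout d n N s f \<Longrightarrow> (\<And>x. x \<in> carrier_vec d \<Longrightarrow> g x = f x) \<Longrightarrow> readout d n N s g"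
  by (auto simp: readout_def)

lemma readout_mono: "readout d n N s f \<Longrightarrow> s \<le> t \<Longrightarrow> readout d n N t f"
  unfolding readout_def using le_trans by blast

lemma readout_const:
  assumes "hidden d n N"
  shows "readout d n N 0 (\<lambda>_. c)"
  unfolding readout_def
  by (rule exI[of _ "0\<^sub>v n"], rule exI[of _ c]) (use final_state_carrier[OF assms] in auto)

lemma readout_add:
  assumes "hidden d n N" "readout d n N s f" "readout d n N t g"
  shows "readout d n N (s + t) (\<lambda>x. f x + g x)"
proof -
  obtain u \<beta> v \<gamma> where u: "u \<in> carrier_vec n" "nnz u \<le> s"
      "\<And>x. x \<in> carrier_vec d \<Longrightarrow> f x = u \<bullet> final_state N x + \<beta>"
    and v: "v \<in> carrier_vec n" "nnz v \<le> t"
      "\<And>x. x \<in> carrier_vec d \<Longrightarrow> g x = v \<bullet> final_state N x + \<gamma>"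
    using assms unfolding readout_def by blast
  have "nnz (u + v) \<le> s + t"
    using nnz_add[OF u(1) v(1)] u(2) v(2) by linarith
  moreover have "f x + g x = (u + v) \<bullet> final_state N x + (\<beta> + \<gamma>)" if "x \<in> carrier_vec d" for x
    using u v that final_state_carrier[OF assms(1) that]
    by (simp add: add_scalar_prod_distrib[of _ n])
  ultimately show ?thesis
    unfolding readout_def using u(1) v(1) by (meson add_carrier_vec)
qed

lemma readout_mult:
  assumes "hidden d n N" "readout d n N s f"
  shows "readout d n N s (\<lambda>x. c * f x)"
proof -
  obtain u \<beta> where u: "u \<in> carrier_vec n" "nnz u \<le> s"
      "\<And>x. x \<in> carrier_vec d \<Longrightarrow> f x = u \<bullet> final_state N x + \<beta>"
    using assms unfolding readout_def by blast
  have "nnz (c \<cdot>\<^sub>v u) \<le> s"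
    using nnz_smult[of c u] u(2) by linarith
  moreover have "c * f x = (c \<cdot>\<^sub>v u) \<bullet> final_state N x + c * \<beta>" if "x \<in> carrier_vec d" for x
    using u that final_state_carrier[OF assms(1) that]
    by (simp add: algebra_simps)
  ultimately show ?thesis
    unfolding readout_def using u(1) by (meson smult_carrier_vec)
qed

lemma readout_uminus:
  assumes "hidden d n N" "readout d n N s f"
  shows "readout d n N s (\<lambda>x. - f x)"
  using readout_mult[OF assms, of "-1"] by simp

lemma readout_diff:
  assumes "hidden d n N" "readout d n N s f" "readout d n N t g"
  shows "readout d n N (s + t) (\<lambda>x. f x - g x)"
  using readout_add[OF assms(1,2) readout_uminus[OF assms(1,3)]] by simp

lemma readout_sum:
  assumes "hidden d n N" "\<And>i. i < k \<Longrightarrow> readout d n N s (f i)"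
  shows "readout d n N (k * s) (\<lambda>x. \<Sum>i<k. f i x)"
  using assms(2)
proof (induction k)
  case 0
  then show ?case using readout_const[OF assms(1)] by simp
next
  case (Suc k)
  then show ?case
    using readout_add[OF assms(1) Suc.IH Suc.prems[of k]] by (simp add: add.commute)
qed

lemma readout_input: "i < d \<Longrightarrow> readout d d [] 1 (\<lambda>x. x $ i)"
  unfolding readout_def
  by (rule exI[of _ "unit_vec d i"], rule exI[of _ 0]) (use nnz_unit in auto)

text \<open>The weight vectors of the readouts become the rows of \<open>A\<close>, their constants
  the entries of \<open>b\<close>. This serves hidden layers and the output layer alike.\<close>

lemma affine_layer:
  assumes "hidden d n N" "\<And>f. f \<in> set fs \<Longrightarrow> readout d n N s f"
  obtains A b where "A \<in> carrier_mat (length fs) n" "b \<in> carrier_vec (length fs)"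
    "layer_nonzero (A, b) \<le> length fs * (s + 1)"
    "\<And>x. x \<in> carrier_vec d \<Longrightarrow> A *\<^sub>v final_state N x + b = vec (length fs) (\<lambda>r. (fs ! r) x)"
proof -
  have "\<exists>w \<beta>. w \<in> carrier_vec n \<and> nnz w \<le> s \<and>
      (\<forall>x\<in>carrier_vec d. (fs ! r) x = w \<bullet> final_state N x + \<beta>)" if "r < length fs" for r
    using assms(2)[of "fs ! r"] that unfolding readout_def by simp
  then obtain w \<beta> where w: "\<And>r. r < length fs \<Longrightarrow> w r \<in> carrier_vec n"
    "\<And>r. r < length fs \<Longrightarrow> nnz (w r) \<le> s"
    "\<And>r x. r < length fs \<Longrightarrow> x \<in> carrier_vec d \<Longrightarrow> (fs ! r) x = w r \<bullet> final_state N x + \<beta> r"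
    by metis
  define A where "A = mat\<^sub>r (length fs) n w"
  have A: "A \<in> carrier_mat (length fs) n" by (simp add: A_def)
  have row: "row A r = w r" if "r < length fs" for r
    using that w(1) by (simp add: A_def row_mat_of_row_fun)
  have "layer_nonzero (A, vec (length fs) \<beta>) \<le> length fs * (s + 1)"
    by (rule layer_nonzero_le[OF A]) (use w row in auto)
  moreover have "A *\<^sub>v final_state N x + vec (length fs) \<beta> = vec (length fs) (\<lambda>r. (fs ! r) x)"
    if "x \<in> carrier_vec d" for x
    by (rule eq_vecI) (use A row w that in auto)
  ultimately show thesis using that A by force
qed

text \<open>The cost drops to 1 whatever \<open>s\<close> was, because each
  \<open>relu (f x)\<close> is one coordinate of the new state. This reset keeps the number of
  weights per neuron from growing with the depth.\<close>

lemma hidden_layer: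
  assumes "hidden d n N" "\<And>f. f \<in> set fs \<Longrightarrow> readout d n N s f" "1 \<le> d" "fs \<noteq> []"
  obtains A b where "hidden d (length fs) (N @ [(A, b)])" "dim_row A = length fs"
    "mlp_nonzero (N @ [(A, b)]) \<le> mlp_nonzero N + length fs * (s + 1)"
    "\<And>f. f \<in> set fs \<Longrightarrow> readout d (length fs) (N @ [(A, b)]) 1 (\<lambda>x. relu (f x))"
proof -
  obtain A b where A: "A \<in> carrier_mat (length fs) n" "b \<in> carrier_vec (length fs)"
    "layer_nonzero (A, b) \<le> length fs * (s + 1)"
    "\<And>x. x \<in> carrier_vec d \<Longrightarrow> A *\<^sub>v final_state N x + b = vec (length fs) (\<lambda>r. (fs ! r) x)"
    using affine_layer[OF assms(1,2)] by metis
  have "1 \<le> length fs" using assms(4) by (simp add: Suc_leI)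
  then have "hidden d (length fs) (N @ [(A, b)])"
    using relu_mlp_append[OF assms(1) A(1,2) assms(3)] by (simp add: hidden_def)
  moreover have "mlp_nonzero (N @ [(A, b)]) \<le> mlp_nonzero N + length fs * (s + 1)"
    using A(3) by (simp add: mlp_nonzero_append)
  moreover have "readout d (length fs) (N @ [(A, b)]) 1 (\<lambda>x. relu (f x))" if f: "f \<in> set fs" for f
  proof -
    obtain r where r: "r < length fs" "fs ! r = f" using f by (auto simp: in_set_conv_nth)
    show ?thesis
      unfolding readout_def final_state_append
      by (rule exI[of _ "unit_vec (length fs) r"], rule exI[of _ 0]) (use nnz_unit A r in auto)
  qed
  ultimately show thesis using that A(1) by auto
qed

subsection \<open>The network of the algorithm\<close>

lemma dist_D_sum:
  assumes "x \<in> carrier_vec d" "node_b \<theta> m \<in> carrier_vec d"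
  shows "dist_D \<theta> x m =
    (\<Sum>i<d. relu (x $ i - node_b \<theta> m $ i) + relu (node_b \<theta> m $ i - x $ i))"
  using assms by (auto simp: dist_D_def scalar_prod_def atLeast0LessThan intro!: sum.cong)

lemma node_b_carrier:
  assumes "\<theta> \<in> param_space d M" "m < M"
  shows "node_b \<theta> m \<in> carrier_vec d"
proof -
  have "\<theta> ! m \<in> UNIV \<times> unit_cube d \<times> {0..}"
    using assms nth_mem[of m \<theta>] by (auto simp: param_space_def)
  then show ?thesis by (auto simp: node_b_def unit_cube_def)
qed

text \<open>Each of the \<open>2 * d * M\<close> neurons has at most one weight and one bias, which
  gives \<open>4 * d * M\<close>. A distance reads \<open>2 * d\<close> neurons; the larger budget
  \<open>3 * d\<close> is the one that also suits the higher levels. Padding leaves read the neurons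
  of the last proper leaf, so \<open>j\<close> is unrestricted.\<close>

lemma leaf_network:
  assumes "1 \<le> d" "1 \<le> M" "\<theta> \<in> param_space d M"
  obtains n N where "hidden d n N" "length N = 1" "\<And>l. l \<in> set N \<Longrightarrow> dim_row (fst l) \<le> 2 * d * M"
    "mlp_nonzero N \<le> 4 * d * M"
    "\<And>j. readout d n N (3 * d) (\<lambda>x. upper_U \<theta> G x 0 j)"
    "\<And>j. readout d n N (3 * d) (\<lambda>x. lower_L \<theta> G x 0 j)"
proof -
  \<comment> \<open>The two ReLU arguments whose outputs add up to the distance in coordinate
    \<open>i\<close>.\<close>
  define two :: "nat \<Rightarrow> nat \<Rightarrow> (real vec \<Rightarrow> real) list" where
    "two m i = [\<lambda>x. x $ i - node_b \<theta> m $ i, \<lambda>x. node_b \<theta> m $ i - x $ i]" for m i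
  define fs where "fs = concat (map (\<lambda>(m, i). two m i) (List.product [0..<M] [0..<d]))"
  have len: "length fs = 2 * d * M"
    by (simp add: fs_def two_def length_concat case_prod_unfold comp_def sum_list_triv)
  then have ne: "fs \<noteq> []" using assms by auto
  have h0: "hidden d d []" by (simp add: hidden_def)
  have set_fs: "set fs = (\<Union>m<M. \<Union>i<d. set (two m i))"
    by (fastforce simp: fs_def)
  have "readout d d [] 1 f" if f: "f \<in> set fs" for f
  proof -
    from f obtain m i where i: "i < d"
      and "f \<in> {\<lambda>x. x $ i - node_b \<theta> m $ i, \<lambda>x. node_b \<theta> m $ i - x $ i}"
      unfolding set_fs two_def list.set by blast
    then show ?thesis
      using readout_diff[OF h0 readout_input[OF i] readout_const[OF h0, of "node_b \<theta> m $ i"]]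
        readout_diff[OF h0 readout_const[OF h0, of "node_b \<theta> m $ i"] readout_input[OF i]]
      by auto
  qed
  then obtain A b where N: "hidden d (length fs) [(A, b)]" "dim_row A = length fs"
    "mlp_nonzero [(A, b)] \<le> mlp_nonzero [] + length fs * 2"
    "\<And>f. f \<in> set fs \<Longrightarrow> readout d (length fs) [(A, b)] 1 (\<lambda>x. relu (f x))"
    using hidden_layer[OF h0 _ assms(1) ne] by (metis append_Nil one_add_one)
  have lenM: "length \<theta> = M" using assms by (simp add: param_space_def)
  let ?R = "\<lambda>s f. readout d (length fs) [(A, b)] s f"
  have D: "?R (d * 2) (\<lambda>x. dist_D \<theta> x m)" if m: "m < M" for m
  proof -
    have "?R (1 + 1) (\<lambda>x. relu (x $ i - node_b \<theta> m $ i) + relu (node_b \<theta> m $ i - x $ i))"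
      if i: "i < d" for i
    proof (intro readout_add[OF N(1)] N(4))
      have "set (two m i) \<subseteq> set fs" using i m by (auto simp: set_fs)
      then show "(\<lambda>x. x $ i - node_b \<theta> m $ i) \<in> set fs" "(\<lambda>x. node_b \<theta> m $ i - x $ i) \<in> set fs"
        unfolding two_def list.set by blast+
    qed
    then have "?R 2 (\<lambda>x. relu (x $ i - node_b \<theta> m $ i) + relu (node_b \<theta> m $ i - x $ i))"
      if "i < d" for i
      using that unfolding one_add_one by blast
    then have "?R (d * 2)
        (\<lambda>x. \<Sum>i<d. relu (x $ i - node_b \<theta> m $ i) + relu (node_b \<theta> m $ i - x $ i))"
      by (intro readout_sum[OF N(1)])
    then show ?thesis
      by (rule readout_cong) (use dist_D_sum node_b_carrier[OF assms(3) m] in auto)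
  qed
  have pad: "pad_index \<theta> j < M" for j
    using assms lenM by (auto simp: pad_index_def)
  \<comment> \<open>The value of \<open>values_V\<close> is a constant and costs nothing; only the
    scaled distance, of cost \<open>d * 2\<close>, counts.\<close>
  have U: "?R (3 * d) (\<lambda>x. upper_U \<theta> G x 0 j)" for j
    using readout_add[OF N(1) readout_const[OF N(1), of "values_V \<theta> G $ pad_index \<theta> j"]
        readout_mult[OF N(1) D[OF pad[of j]], of "slope_c \<theta> (pad_index \<theta> j)"]]
    unfolding upper_U.simps Let_def by (rule readout_mono) simp
  have L: "?R (3 * d) (\<lambda>x. lower_L \<theta> G x 0 j)" for j
    using readout_diff[OF N(1) readout_const[OF N(1), of "values_V \<theta> G $ pad_index \<theta> j"]
        readout_mult[OF N(1) D[OF pad[of j]], of "slope_c \<theta> (pad_index \<theta> j)"]]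
    unfolding lower_L.simps Let_def by (rule readout_mono) simp
  have "mlp_nonzero [(A, b)] \<le> 4 * d * M"
    using N(3) len by (simp add: mlp_nonzero_def)
  moreover have "length [(A, b)] = 1" "dim_row (fst l) \<le> 2 * d * M" if "l \<in> set [(A, b)]" for l
    using that N(2) len by auto
  ultimately show thesis
    by (intro that[OF N(1) _ _ _ U L]) simp_all
qed

text \<open>
  The bound on the parameters is \<open>4dM\<close> plus a multiple of \<open>2\<^sup>K - 2\<^sup>K\<^sup>-\<^sup>l\<close>, written without subtraction.
\<close>

lemma tree_network:
  assumes "1 \<le> d" "1 \<le> M" "\<theta> \<in> param_space d M" "l \<le> K" "2 ^ K \<le> 2 * M"
  shows "\<exists>n N. hidden d n N \<and> length N = Suc l \<and> (\<forall>l\<in>set N. dim_row (fst l) \<le> 6 * d * M) \<and>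
    mlp_nonzero N + 6 * (6 * d + 1) * 2 ^ (K - l) \<le> 4 * d * M + 6 * (6 * d + 1) * 2 ^ K \<and>
    (\<forall>j<2 ^ (K - l). readout d n N (3 * d) (\<lambda>x. upper_U \<theta> G x l j) \<and>
                     readout d n N (3 * d) (\<lambda>x. lower_L \<theta> G x l j))"
  using assms(4)
proof (induction l)
  case 0
  obtain n N where N: "hidden d n N" "length N = 1" "\<And>l. l \<in> set N \<Longrightarrow> dim_row (fst l) \<le> 2 * d * M"
    "mlp_nonzero N \<le> 4 * d * M"
    "\<And>j. readout d n N (3 * d) (\<lambda>x. upper_U \<theta> G x 0 j)"
    "\<And>j. readout d n N (3 * d) (\<lambda>x. lower_L \<theta> G x 0 j)"
    using leaf_network[OF assms(1-3)] by metis
  have "dim_row (fst l) \<le> 6 * d * M" if "l \<in> set N" for l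
    using N(3)[OF that] by (rule order_trans) simp
  then show ?case
    using N by (intro exI[of _ n] exI[of _ N]) auto
next
  case (Suc l)
  \<comment> \<open>The new level has \<open>k\<close> nodes, whose children are the
    \<open>2 * k\<close> nodes of the previous level.\<close>
  define k :: nat where "k = 2 ^ (K - Suc l)"
  have k2: "2 ^ (K - l) = 2 * k"
    using Suc.prems by (simp add: k_def Suc_diff_Suc flip: power_Suc)
  \<comment> \<open>A level above the leaves has at most half of the
    \<open>2 ^ K \<le> 2 * M\<close> padded leaves; this controls the width.\<close>
  have "k \<le> M"
  proof -
    have "2 * k \<le> 2 ^ K" unfolding k2[symmetric] by (rule power_increasing) auto
    then show ?thesis using assms(5) by linarith
  qed
  obtain n N where N: "hidden d n N" "length N = Suc l"
    "\<forall>l\<in>set N. dim_row (fst l) \<le> 6 * d * M"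
    "mlp_nonzero N + 6 * (6 * d + 1) * (2 * k) \<le> 4 * d * M + 6 * (6 * d + 1) * 2 ^ K"
    and U: "\<And>j. j < 2 * k \<Longrightarrow> readout d n N (3 * d) (\<lambda>x. upper_U \<theta> G x l j)"
    and L: "\<And>j. j < 2 * k \<Longrightarrow> readout d n N (3 * d) (\<lambda>x. lower_L \<theta> G x l j)"
    using Suc.IH Suc.prems unfolding k2 by auto
  define u where "u j x = upper_U \<theta> G x l j" for j x
  define v where "v j x = lower_L \<theta> G x l j" for j x
  \<comment> \<open>The first three entries are the ReLU arguments in \<open>Min2\<close> of the two
    children, the last three those in \<open>Max2\<close>, with signs reversed because
    \<open>Max2\<close> negates its arguments.\<close>
  define six where "six j = [\<lambda>x. u (2*j+1) x, \<lambda>x. - u (2*j+1) x, \<lambda>x. u (2*j+1) x - u (2*j) x,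
     \<lambda>x. - v (2*j+1) x, \<lambda>x. v (2*j+1) x, \<lambda>x. v (2*j) x - v (2*j+1) x]" for j
  define fs where "fs = concat (map six [0..<k])"
  have len: "length fs = 6 * k"
    by (simp add: fs_def length_concat six_def comp_def sum_list_triv)
  have ne: "fs \<noteq> []" using len by (auto simp: k_def)
  \<comment> \<open>The costliest entries are the differences of two readouts of cost
    \<open>3 * d\<close> each.\<close>
  have six: "readout d n N (6 * d) f" if "j < k" "f \<in> set (six j)" for j f
  proof -
    have "readout d n N (3 * d) (u i)" "readout d n N (3 * d) (v i)" if "i \<in> {2*j, 2*j+1}" for i
      using U[of i] L[of i] that \<open>j < k\<close> by (auto simp: u_def[abs_def] v_def[abs_def])
    then have uv: "readout d n N (3 * d) (u (2*j))" "readout d n N (3 * d) (v (2*j))"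
      "readout d n N (3 * d) (u (2*j+1))" "readout d n N (3 * d) (v (2*j+1))"
      by blast+
    have 3: "3 * d \<le> 6 * d" and 6: "6 * d = 3 * d + 3 * d" by simp_all
    show ?thesis
      using that(2) readout_mono[OF uv(3) 3] readout_mono[OF uv(4) 3]
        readout_mono[OF readout_uminus[OF N(1) uv(3)] 3]
        readout_mono[OF readout_uminus[OF N(1) uv(4)] 3]
        readout_diff[OF N(1) uv(3) uv(1), folded 6]
        readout_diff[OF N(1) uv(2) uv(4), folded 6]
      unfolding six_def list.set by blast
  qed
  have "readout d n N (6 * d) f" if "f \<in> set fs" for f
    using that six by (auto simp: fs_def)
  then obtain A b where N': "hidden d (length fs) (N @ [(A, b)])" "dim_row A = length fs"
    "mlp_nonzero (N @ [(A, b)]) \<le> mlp_nonzero N + length fs * (6 * d + 1)"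
    "\<And>f. f \<in> set fs \<Longrightarrow> readout d (length fs) (N @ [(A, b)]) 1 (\<lambda>x. relu (f x))"
    using hidden_layer[OF N(1) _ assms(1) ne] by metis
  let ?R = "\<lambda>s f. readout d (length fs) (N @ [(A, b)]) s f"
  have "?R (3 * d) (\<lambda>x. upper_U \<theta> G x (Suc l) j) \<and> ?R (3 * d) (\<lambda>x. lower_L \<theta> G x (Suc l) j)"
    if "j < k" for j
  proof -
    have r: "?R 1 (\<lambda>x. relu (f x))" if "f \<in> set (six j)" for f
      by (rule N'(4)) (use that \<open>j < k\<close> in \<open>auto simp: fs_def\<close>)
    have r: "?R 1 (\<lambda>x. relu (u (2*j+1) x))" "?R 1 (\<lambda>x. relu (- u (2*j+1) x))"
      "?R 1 (\<lambda>x. relu (u (2*j+1) x - u (2*j) x))"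
      "?R 1 (\<lambda>x. relu (- v (2*j+1) x))" "?R 1 (\<lambda>x. relu (v (2*j+1) x))"
      "?R 1 (\<lambda>x. relu (v (2*j) x - v (2*j+1) x))"
      by (rule r, simp add: six_def)+
    \<comment> \<open>A new node reads three neurons at cost 1 each, so \<open>1 \<le> d\<close>
      restores the budget \<open>3 * d\<close>.\<close>
    have 3: "1 + 1 + 1 \<le> 3 * d" using assms(1) by simp
    have "?R (3 * d) (\<lambda>x. relu (u (2*j+1) x) - relu (- u (2*j+1) x) - relu (u (2*j+1) x - u (2*j) x))"
      by (intro readout_mono[OF readout_diff[OF N'(1) readout_diff[OF N'(1)]] 3] r)
    moreover have
      "?R (3 * d) (\<lambda>x. - (relu (- v (2*j+1) x) - relu (v (2*j+1) x) - relu (v (2*j) x - v (2*j+1) x)))"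
      by (intro readout_uminus[OF N'(1)] readout_mono[OF readout_diff[OF N'(1) readout_diff[OF N'(1)]] 3] r)
    ultimately show ?thesis
      by (simp add: Min2_def Max2_def u_def v_def)
  qed
  moreover have "length fs \<le> 6 * d * M"
    using len \<open>k \<le> M\<close> assms(1) mult_le_mono[of 1 d k M] by simp
  \<comment> \<open>The layer adds at most \<open>6 * k * (6 * d + 1)\<close>, which is half of the
    reserve term of the previous level; the other half is the reserve of the new level.\<close>
  moreover have "mlp_nonzero (N @ [(A, b)]) + 6 * (6 * d + 1) * k \<le> 4 * d * M + 6 * (6 * d + 1) * 2 ^ K"
    using N'(3) N(4) len by (simp add: algebra_simps)
  ultimately show ?case
    using N'(1,2) N(2,3) unfolding k_def[symmetric]
    by (intro exI[of _ "length fs"] exI[of _ "N @ [(A, b)]"]) auto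
qed

text \<open>The depth counts the leaf layer, \<open>tree_height M\<close> tree layers and the affine
  output layer. At the top level only the two roots remain, and half their sum is a readout of cost
  \<open>6 * d\<close>, the single row of the output layer.\<close>

lemma Phi_network:
  assumes "1 \<le> d" "1 \<le> M" "\<theta> \<in> param_space d M" "2 ^ tree_height M \<le> 2 * M"
  shows "\<exists>N. relu_mlp d 1 N \<and> (\<forall>x\<in>carrier_vec d. mlp_map N x = vec 1 (\<lambda>_. Phi \<theta> G x)) \<and>
    mlp_depth N = tree_height M + 2 \<and> mlp_width N \<le> 6 * d * M \<and> mlp_nonzero N \<le> 100 * d * M"
proof -
  define K where "K = tree_height M"
  obtain n N where N: "hidden d n N" "length N = Suc K" "\<forall>l\<in>set N. dim_row (fst l) \<le> 6 * d * M"
    "mlp_nonzero N \<le> 4 * d * M + 6 * (6 * d + 1) * 2 ^ K"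
    "readout d n N (3 * d) (\<lambda>x. upper_U \<theta> G x K 0)" "readout d n N (3 * d) (\<lambda>x. lower_L \<theta> G x K 0)"
    using tree_network[OF assms(1-3) order_refl assms(4), of G] unfolding K_def[symmetric] by auto
  have lenM: "length \<theta> = M" using assms by (simp add: param_space_def)
  have "readout d n N (6 * d) (Phi \<theta> G)"
    using readout_mult[OF N(1) readout_add[OF N(1) N(5,6)], of "1/2"]
    by (simp add: Phi_def[abs_def] Let_def lenM K_def)
  then obtain A b where A: "A \<in> carrier_mat 1 n" "b \<in> carrier_vec 1"
    "layer_nonzero (A, b) \<le> 6 * d + 1"
    "\<And>x. x \<in> carrier_vec d \<Longrightarrow> A *\<^sub>v final_state N x + b = vec 1 (\<lambda>r. ([Phi \<theta> G] ! r) x)"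
    using affine_layer[OF N(1), of "[Phi \<theta> G]" "6 * d"] by auto
  have mlp: "relu_mlp d 1 (N @ [(A, b)])"
    by (rule relu_mlp_append[OF N(1) A(1,2) assms(1)]) simp
  have dM: "d \<le> d * M" "M \<le> d * M" "1 \<le> d * M" using assms by simp_all
  have "mlp_width (N @ [(A, b)]) \<le> 6 * d * M"
    by (rule mlp_width_le[OF mlp]) (use dM N(3) A(1) in auto)
  moreover have "mlp_map (N @ [(A, b)]) x = vec 1 (\<lambda>_. Phi \<theta> G x)" if "x \<in> carrier_vec d" for x
    using A(4)[OF that] by (auto simp: mlp_map_append)
  moreover have "mlp_nonzero (N @ [(A, b)]) \<le> 100 * d * M"
  proof -
    have "6 * (6 * d + 1) * 2 ^ K \<le> 6 * (6 * d + 1) * (2 * M)"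
      using assms(4) unfolding K_def by (intro mult_le_mono2)
    then have "mlp_nonzero (N @ [(A, b)]) \<le> 4 * (d * M) + (72 * (d * M) + 12 * M) + (6 * d + 1)"
      using A(3) N(4) unfolding mlp_nonzero_append by (simp add: algebra_simps)
    \<comment> \<open>Each of \<open>d\<close>, \<open>M\<close> and 1 is at most
      \<open>d * M\<close>, so the coefficients sum to 4 + 72 + 12 + 6 + 1 = 95.\<close>
    also have "\<dots> \<le> 100 * (d * M)" using dM by linarith
    finally show ?thesis by simp
  qed
  ultimately show ?thesis
    using mlp N(2) by (intro exI[of _ "N @ [(A, b)]"]) (auto simp: mlp_depth_def K_def)
qed

subsection \<open>The tree computes the extrema\<close>

text \<open>\<open>relu t - relu (- t)\<close> is \<open>t\<close>, and subtracting
  \<open>relu (t - s)\<close> lowers it to \<open>s\<close> exactly when \<open>t\<close> exceeds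
  \<open>s\<close>.\<close>

lemma Min2_eq_min: "Min2 s t = min s t"
  by (auto simp: Min2_def relu_def)

lemma Max2_eq_max: "Max2 s t = max s t"
  by (auto simp: Max2_def Min2_eq_min)

text \<open>Node \<open>j\<close> at level \<open>l\<close> covers \<open>2 ^ l\<close> consecutive
  leaves; the blocks of two siblings fill that of their parent.\<close>

lemma block_split:
  "{2 * j * 2 ^ l..<(2 * j + 1) * 2 ^ l} \<union> {(2 * j + 1) * 2 ^ l..<(2 * j + 2) * 2 ^ l} =
   {j * 2 ^ Suc l..<(j + 1) * 2 ^ Suc l :: nat}"
  by (auto simp: algebra_simps)

lemma block_nonempty: "{j * 2 ^ l..<(j + 1) * 2 ^ l :: nat} \<noteq> {}"
  by simp

text \<open>Induction on the level for all \<open>j\<close> at once: the minimum over a union of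
  finite nonempty blocks is the smaller of the two minima.\<close>

lemma upper_U_eq_Min:
  "upper_U \<theta> G x l j = (MIN r\<in>{j * 2 ^ l..<(j + 1) * 2 ^ l}. upper_U \<theta> G x 0 r)"
proof (induction l arbitrary: j)
  case 0
  have "{j..<Suc j} = {j}" by auto
  then show ?case by simp
next
  case (Suc l)
  have "upper_U \<theta> G x (Suc l) j = min (upper_U \<theta> G x l (2 * j)) (upper_U \<theta> G x l (2 * j + 1))"
    by (simp add: Min2_eq_min)
  also have "\<dots> = (MIN r\<in>{2 * j * 2 ^ l..<(2 * j + 1) * 2 ^ l} \<union>
      {(2 * j + 1) * 2 ^ l..<(2 * j + 1 + 1) * 2 ^ l}. upper_U \<theta> G x 0 r)"
    unfolding Suc.IH image_Un
    by (rule Min_Un[symmetric]) (use block_nonempty in \<open>blast intro: finite_imageI\<close>)+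
  finally show ?case by (simp only: block_split[symmetric] add.assoc one_add_one)
qed

lemma lower_L_eq_Max:
  "lower_L \<theta> G x l j = (MAX r\<in>{j * 2 ^ l..<(j + 1) * 2 ^ l}. lower_L \<theta> G x 0 r)"
proof (induction l arbitrary: j)
  case 0
  have "{j..<Suc j} = {j}" by auto
  then show ?case by simp
next
  case (Suc l)
  have "lower_L \<theta> G x (Suc l) j = max (lower_L \<theta> G x l (2 * j)) (lower_L \<theta> G x l (2 * j + 1))"
    by (simp add: Max2_eq_max)
  also have "\<dots> = (MAX r\<in>{2 * j * 2 ^ l..<(2 * j + 1) * 2 ^ l} \<union>
      {(2 * j + 1) * 2 ^ l..<(2 * j + 1 + 1) * 2 ^ l}. lower_L \<theta> G x 0 r)"
    unfolding Suc.IH image_Un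
    by (rule Max_Un[symmetric]) (use block_nonempty in \<open>blast intro: finite_imageI\<close>)+
  finally show ?case by (simp only: block_split[symmetric] add.assoc one_add_one)
qed

section \<open>Logarithmic bounds on the height of the tree\<close>

lemma tree_height_bounds:
  assumes "1 \<le> M"
  shows "M \<le> 2 ^ tree_height M" "2 ^ tree_height M \<le> 2 * M"
    "real (tree_height M) \<le> 2 * ln (real M) + 1"
proof -
  \<comment> \<open>Since the logarithm is nonnegative, \<open>nat\<close> does not truncate the
    ceiling.\<close>
  have log0: "0 \<le> log 2 (real M)" using assms by simp
  then have K: "log 2 (real M) \<le> real (tree_height M)" "real (tree_height M) \<le> log 2 (real M) + 1"
    unfolding tree_height_def by linarith+
  have "real M = 2 powr log 2 (real M)" using assms by simp
  also have "\<dots> \<le> 2 powr real (tree_height M)" using K by simp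
  finally have "real M \<le> real (2 ^ tree_height M)" by (simp add: powr_realpow)
  then show "M \<le> 2 ^ tree_height M" by linarith
  have "2 powr real (tree_height M) \<le> 2 powr (log 2 (real M) + 1)" using K by simp
  also have "\<dots> = 2 * real M" using assms by (simp add: powr_add)
  finally have "real (2 ^ tree_height M) \<le> real (2 * M)" by (simp add: powr_realpow)
  then show "2 ^ tree_height M \<le> 2 * M" by linarith
  \<comment> \<open>From \<open>ln (1 / 2) \<le> 1 / 2 - 1\<close>; this is the origin of the factor
    2 in passing from base 2 to \<open>ln\<close>.\<close>
  have "1 \<le> 2 * ln (2 :: real)"
    using ln_le_minus_one[of "1 / 2 :: real"] by (simp add: ln_div)
  then have "log 2 (real M) * 1 \<le> log 2 (real M) * (2 * ln 2)"
    using log0 by (intro mult_left_mono)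
  also have "\<dots> = 2 * ln (real M)" by (simp add: log_def)
  finally show "real (tree_height M) \<le> 2 * ln (real M) + 1" using K by linarith
qed

section \<open>Identification of \<open>Phi\<close> with \<open>f_hat\<close>\<close>

lemma dist_D_eq_l1_norm:
  assumes "x \<in> carrier_vec d" "node_b \<theta> m \<in> carrier_vec d"
  shows "dist_D \<theta> x m = l1_norm (x - node_b \<theta> m)"
  \<comment> \<open>Coordinatewise, \<open>relu t + relu (- t)\<close> is the absolute value of
    \<open>t\<close>.\<close>
  unfolding dist_D_sum[OF assms] l1_norm_def
  using assms by (auto simp: relu_def intro!: sum.cong)

text \<open>Padding only repeats the last leaf, and \<open>M \<le> P\<close> loses none, so extrema
  over the padded leaves are extrema over the original ones.\<close>

lemma pad_index_image:
  assumes "length \<theta> = M" "1 \<le> M" "M \<le> P"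
  shows "pad_index \<theta> ` {..<P} = {..<M}"
proof
  show "pad_index \<theta> ` {..<P} \<subseteq> {..<M}" using assms by (auto simp: pad_index_def)
  show "{..<M} \<subseteq> pad_index \<theta> ` {..<P}"
  proof
    fix m assume "m \<in> {..<M}"
    then show "m \<in> pad_index \<theta> ` {..<P}"
      using assms by (intro image_eqI[of _ _ m]) (auto simp: pad_index_def)
  qed
qed

lemma Phi_eq_f_hat:
  assumes "1 \<le> M" "\<theta> \<in> param_space d M" "x \<in> carrier_vec d"
  shows "Phi \<theta> G x = f_hat \<theta> G x"
proof -
  define K where "K = tree_height M"
  have lenM: "length \<theta> = M" using assms by (simp add: param_space_def)
  have pad: "pad_index \<theta> ` {..<2 ^ K} = {..<M}"
    unfolding K_def by (rule pad_index_image[OF lenM assms(1) tree_height_bounds(1)[OF assms(1)]])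
  have D: "dist_D \<theta> x m = l1_norm (x - node_b \<theta> m)" if "m \<in> {..<M}" for m
    using that dist_D_eq_l1_norm[OF assms(3) node_b_carrier[OF assms(2)]] by simp
  have "upper_U \<theta> G x 0 ` {..<2 ^ K} =
      (\<lambda>m. values_V \<theta> G $ m + slope_c \<theta> m * dist_D \<theta> x m) ` (pad_index \<theta> ` {..<2 ^ K})"
    by (simp add: image_image Let_def)
  also have "\<dots> = (\<lambda>m. values_V \<theta> G $ m + slope_c \<theta> m * l1_norm (x - node_b \<theta> m)) ` {..<M}"
    unfolding pad by (rule image_cong) (simp_all add: D)
  finally have U: "upper_U \<theta> G x 0 ` {..<2 ^ K} = \<dots>" .
  have "lower_L \<theta> G x 0 ` {..<2 ^ K} =
      (\<lambda>m. values_V \<theta> G $ m - slope_c \<theta> m * dist_D \<theta> x m) ` (pad_index \<theta> ` {..<2 ^ K})"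
    by (simp add: image_image Let_def)
  also have "\<dots> = (\<lambda>m. values_V \<theta> G $ m - slope_c \<theta> m * l1_norm (x - node_b \<theta> m)) ` {..<M}"
    unfolding pad by (rule image_cong) (simp_all add: D)
  finally have L: "lower_L \<theta> G x 0 ` {..<2 ^ K} = \<dots>" .
  \<comment> \<open>The block of the root, with level \<open>K\<close> and index 0, consists of all
    \<open>2 ^ K\<close> leaves.\<close>
  have "upper_U \<theta> G x K 0 = Min (upper_U \<theta> G x 0 ` {..<2 ^ K})"
    by (subst upper_U_eq_Min) (simp add: atLeast0LessThan)
  moreover have "lower_L \<theta> G x K 0 = Max (lower_L \<theta> G x 0 ` {..<2 ^ K})"
    by (subst lower_L_eq_Max) (simp add: atLeast0LessThan)
  ultimately show ?thesis
    unfolding Phi_def f_hat_def Let_def lenM K_def[symmetric] U L by simp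
qed

theorem proposition3p5:
  fixes d :: nat
  assumes "1 \<le> d"
  shows "\<exists>K_depth K_width K_params :: real.
    \<forall>M\<ge>1. \<forall>G\<in>carrier_mat M M. \<forall>\<theta>\<in>param_space d M.
      (\<exists>N. relu_mlp d 1 N \<and>
           (\<forall>x\<in>carrier_vec d. mlp_map N x = vec 1 (\<lambda>_. Phi \<theta> G x)) \<and>
           real (mlp_depth N) \<le> K_depth * max 1 (ln (real M)) \<and>
           real (mlp_width N) \<le> K_width * max 1 (real M) \<and>
           real (mlp_nonzero N) \<le> K_params * max 1 (real M)) \<and>
      (\<forall>x\<in>unit_cube d. Phi \<theta> G x = f_hat \<theta> G x)"
\<comment> \<open>The 5 comes from \<open>tree_height M + 2 \<le> 2 * ln (real M) + 3\<close>. In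
  the other two bounds the maximum is \<open>real M\<close>, so the constants are read off from
  \<open>Phi_network\<close>.\<close>
proof (rule exI[of _ 5], rule exI[of _ "real (6 * d)"], rule exI[of _ "real (100 * d)"],
    intro allI impI ballI conjI)
  fix M :: nat and G :: "real mat" and \<theta>
  assume M: "1 \<le> M" and \<theta>: "\<theta> \<in> param_space d M"
  obtain N where N: "relu_mlp d 1 N" "\<forall>x\<in>carrier_vec d. mlp_map N x = vec 1 (\<lambda>_. Phi \<theta> G x)"
    "mlp_depth N = tree_height M + 2" "mlp_width N \<le> 6 * d * M" "mlp_nonzero N \<le> 100 * d * M"
    using Phi_network[OF assms M \<theta> tree_height_bounds(2)[OF M]] by blast
  have "real (mlp_depth N) \<le> 5 * max 1 (ln (real M))"
    using N(3) tree_height_bounds(3)[OF M] by (simp add: max_def split: if_splits)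
  moreover have "real (mlp_width N) \<le> real (6 * d) * max 1 (real M)"
    using of_nat_mono[OF N(4), where 'a = real] M by (simp add: max_def)
  moreover have "real (mlp_nonzero N) \<le> real (100 * d) * max 1 (real M)"
    using of_nat_mono[OF N(5), where 'a = real] M by (simp add: max_def)
  ultimately show "\<exists>N. relu_mlp d 1 N \<and>
           (\<forall>x\<in>carrier_vec d. mlp_map N x = vec 1 (\<lambda>_. Phi \<theta> G x)) \<and>
           real (mlp_depth N) \<le> 5 * max 1 (ln (real M)) \<and>
           real (mlp_width N) \<le> real (6 * d) * max 1 (real M) \<and>
           real (mlp_nonzero N) \<le> real (100 * d) * max 1 (real M)"
    using N(1,2) by blast
next
  fix M :: nat and G :: "real mat" and \<theta> x
  assume "1 \<le> M" "\<theta> \<in> param_space d M" "x \<in> unit_cube d"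
  then show "Phi \<theta> G x = f_hat \<theta> G x"
    using Phi_eq_f_hat by (auto simp: unit_cube_def)
qed

end
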